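(* Let $d\ge 1$, $\nu>0$ and $\alpha=1-\frac{2}{\nu+d}$ (so that $\alpha$ ranges over $((d-2)/d,1)$ as $\nu$ ranges over $(0,\infty)$). The $d$-dimensional Student distributions with fixed degrees of freedom $\nu$, $\{p_\theta\}$, parametrized by $\theta=[\mu_i,\sigma_{ij}]^\top_{i,j\in\{1,\dots,d\},\,i\le j}$, form a regular ($d(d+3)/2$-parameter) $\mathbb{B}^{(\alpha)}$-family.
   Context: Student distributions: for $\boldsymbol{\mu}=[\mu_1,\dots,\mu_d]^\top\in\mathbb{R}^d$, $\boldsymbol{\Sigma}=(\sigma_{ij})$ a symmetric positive-definite $d\times d$ matrix and $\nu>0$, the $d$-dimensional Student distribution is the density on $\mathbb{R}^d$ $$p_\theta(\mathbf{x})=N_{\theta,\alpha}\big[1+b_\alpha(\mathbf{x}-\boldsymbol{\mu})^\top\boldsymbol{\Sigma}^{-1}(\mathbf{x}-\boldsymbol{\mu})\big]^{\frac{1}{\alpha-1}},$$ where $\alpha=1-\frac{2}{\nu+d}$, $b_\alpha=\frac1\nu=\frac{1-\alpha}{2-d(1-\alpha)}$, and $N_{\theta,\alpha}=\frac{\Gamma((\nu+d)/2)}{\Gamma(\nu/2)(\nu\pi)^{d/2}|\boldsymbol{\Sigma}|^{1/2}}$. Here $\theta=[\mu_i,\sigma_{ij}]^\top_{i\le j}$ ranges over the open set $\Theta\subset\mathbb{R}^{d(d+3)/2}$ for which $\boldsymbol{\Sigma}$ is positive definite. $\mathbb{B}^{(\alpha)}$-family ($\alpha\neq1$): a family of probability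 distributions $\{p_\theta:\theta\in\Theta\}$ on $\mathbb{R}^d$, $\Theta\subset\mathbb{R}^k$ open, with $\mathbb{S}$ the support of $p_\theta$, is a $k$-parameter $\mathbb{B}^{(\alpha)}$-family characterized by $h,w,f,\Theta,\mathbb{S}$ if there are $w=[w_1,\dots,w_s]^\top$ with each $w_i:\Theta\to\mathbb{R}$ differentiable, $f=[f_1,\dots,f_s]^\top$ with $f_i:\mathbb{R}^d\to\mathbb{R}$, $h:\mathbb{R}^d\to\mathbb{R}$, and a differentiable $F:\Theta\to\mathbb{R}$ with $$p_\theta(\mathbf{x})=[h(\mathbf{x})+F(\theta)+w(\theta)^\top f(\mathbf{x})]^{\frac1{\alpha-1}}\ \text{ for }\mathbf{x}\in\mathbb{S},\qquad p_\theta(\mathbf{x})=0\ \text{ otherwise}.$$ It is regular if (i) $\mathbb{S}$ does not depend on $\theta$; (ii) $s=k$; (iii) $1,w_1,\dots,w_s$ are linearly independent functions on $\Theta$; (iv) $1,f_1,\dots,f_s$ are linearly independent functions on $\mathbb{S}$. *)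

theory Defs
  imports "HOL-Probability.Probability"
begin

section \<open>B-families of order \<open>\<alpha>\<close>\<close>

definition linearly_independent_functions ::
    "'a set \<Rightarrow> 'i set \<Rightarrow> ('i \<Rightarrow> 'a \<Rightarrow> real) \<Rightarrow> bool" where
  "linearly_independent_functions X I g \<longleftrightarrow>
     (\<forall>c :: 'i \<Rightarrow> real. (\<forall>x\<in>X. (\<Sum>i\<in>I. c i * g i x) = 0) \<longrightarrow> (\<forall>i\<in>I. c i = 0))"

definition probability_density :: "(real ^ 'd \<Rightarrow> real) \<Rightarrow> bool" where
  "probability_density q \<longleftrightarrow>
     q \<in> borel_measurable lborel \<and> (\<forall>x. 0 \<le> q x) \<and>
     prob_space (density lborel (\<lambda>x. ennreal (q x)))"

definition density_support :: "('a \<Rightarrow> real) \<Rightarrow> 'a set" where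
  "density_support q = {x. 0 < q x}"

text \<open>
  The base of the real power is required to be positive on the support, since \<open>powr\<close> is total
  and does not agree with the usual power for a negative base. The support \<open>S \<theta>\<close> may depend
  on \<open>\<theta>\<close>; the functions \<open>w\<close> and \<open>f\<close> are indexed by \<open>1, \<dots>, s\<close>.
\<close>

definition B_family_characterized_by ::
    "real \<Rightarrow> (real ^ 'k \<Rightarrow> real ^ 'd \<Rightarrow> real) \<Rightarrow> nat \<Rightarrow> (real ^ 'd \<Rightarrow> real) \<Rightarrow> (real ^ 'k \<Rightarrow> real) \<Rightarrow>
     (nat \<Rightarrow> real ^ 'k \<Rightarrow> real) \<Rightarrow> (nat \<Rightarrow> real ^ 'd \<Rightarrow> real) \<Rightarrow> (real ^ 'k) set \<Rightarrow>
     (real ^ 'k \<Rightarrow> (real ^ 'd) set) \<Rightarrow> bool" where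
  "B_family_characterized_by \<alpha> p s h F w f \<Theta> S \<longleftrightarrow>
     \<alpha> \<noteq> 1 \<and> open \<Theta> \<and>
     (\<forall>\<theta>\<in>\<Theta>. probability_density (p \<theta>) \<and> S \<theta> = density_support (p \<theta>)) \<and>
     (\<forall>i\<in>{1..s}. w i differentiable_on \<Theta>) \<and>
     F differentiable_on \<Theta> \<and>
     (\<forall>\<theta>\<in>\<Theta>. \<forall>x\<in>S \<theta>.
        0 < h x + F \<theta> + (\<Sum>i=1..s. w i \<theta> * f i x) \<and>
        p \<theta> x = (h x + F \<theta> + (\<Sum>i=1..s. w i \<theta> * f i x)) powr (1 / (\<alpha> - 1))) \<and>
     (\<forall>\<theta>\<in>\<Theta>. \<forall>x. x \<notin> S \<theta> \<longrightarrow> p \<theta> x = 0)"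

text \<open>
  Slot \<open>0\<close> of the families \<open>w\<close> and \<open>f\<close> is overwritten by the constant function \<open>1\<close>, so that
  the independence conditions concern \<open>1, w 1, \<dots>, w s\<close> and \<open>1, f 1, \<dots>, f s\<close>.
\<close>

definition regular_B_family ::
    "real \<Rightarrow> nat \<Rightarrow> (real ^ 'k) set \<Rightarrow> (real ^ 'k \<Rightarrow> real ^ 'd \<Rightarrow> real) \<Rightarrow> bool" where
  "regular_B_family \<alpha> k \<Theta> p \<longleftrightarrow>
     k = CARD('k) \<and>
     (\<exists>s h F w f S.
        B_family_characterized_by \<alpha> p s h F w f \<Theta> S \<and>
        (\<forall>\<theta>\<in>\<Theta>. \<forall>\<theta>'\<in>\<Theta>. S \<theta> = S \<theta>') \<and>
        s = k \<and>
        linearly_independent_functions \<Theta> {0..s} (w(0 := (\<lambda>_. 1))) \<and>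
        (\<forall>\<theta>\<in>\<Theta>. linearly_independent_functions (S \<theta>) {0..s} (f(0 := (\<lambda>_. 1)))))"

section \<open>Student distributions\<close>

text \<open>
  Parameter vectors \<open>[\<mu>\<^sub>i, \<sigma>\<^sub>i\<^sub>j]\<close> with \<open>i \<le> j\<close> are elements of \<open>real ^ ('d + 'd upper_index)\<close>: the
  coordinates \<open>Inl i\<close> hold the mean vector, the coordinates \<open>Inr (i, j)\<close> the entries of the
  upper triangle (diagonal included) of the matrix. The linear order on the index type \<open>'d\<close>
  serves only to express \<open>i \<le> j\<close>.
\<close>

typedef (overloaded) ('d :: linorder) upper_index = "{(i :: 'd, j). i \<le> j}"
  by auto

instance upper_index :: ("{finite, linorder}") finite
  by standard
    (rule finite_imageD[where f = Rep_upper_index], simp_all add: inj_on_def Rep_upper_index_inject)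

type_synonym 'd student_param = "real ^ ('d + 'd upper_index)"

definition student_mean :: "'d::{finite,linorder} student_param \<Rightarrow> real ^ 'd::{finite,linorder}" where
  "student_mean \<theta> = (\<chi> i. \<theta> $ Inl i)"

definition student_scale :: "'d::{finite,linorder} student_param \<Rightarrow> real ^ 'd::{finite,linorder} ^ 'd::{finite,linorder}" where
  "student_scale \<theta> = (\<chi> i j. \<theta> $ Inr (Abs_upper_index (min i j, max i j)))"

definition symmetric_positive_definite :: "real ^ 'd ^ 'd \<Rightarrow> bool" where
  "symmetric_positive_definite A \<longleftrightarrow>
     transpose A = A \<and> (\<forall>x. x \<noteq> 0 \<longrightarrow> 0 < x \<bullet> (A *v x))"

definition student_params :: "'d::{finite,linorder} student_param set" where
  "student_params = {\<theta>. symmetric_positive_definite (student_scale \<theta>)}"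

definition student_alpha :: "nat \<Rightarrow> real \<Rightarrow> real" where
  "student_alpha d \<nu> = 1 - 2 / (\<nu> + real d)"

definition student_normalizer :: "real \<Rightarrow> 'd::{finite,linorder} student_param \<Rightarrow> real" where
  "student_normalizer \<nu> \<theta> =
     Gamma ((\<nu> + real CARD('d)) / 2) /
     (Gamma (\<nu> / 2) * (\<nu> * pi) powr (real CARD('d) / 2) * sqrt (det (student_scale \<theta>)))"

definition student_density ::
    "real \<Rightarrow> 'd::{finite,linorder} student_param \<Rightarrow> real ^ 'd::{finite,linorder} \<Rightarrow> real" where
  "student_density \<nu> \<theta> x =
     student_normalizer \<nu> \<theta> *
     (1 + 1 / \<nu> * ((x - student_mean \<theta>) \<bullet>
        (matrix_inv (student_scale \<theta>) *v (x - student_mean \<theta>))))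
       powr (1 / (student_alpha CARD('d) \<nu> - 1))"

end

theory Submission
  imports Defs
begin

text \<open>
  Raising the Student density to the power \<open>\<alpha> - 1\<close> gives a quadratic polynomial in \<open>x\<close>, namely
  \<open>N powr (\<alpha> - 1) * (1 + (x - \<mu>) \<bullet> P (x - \<mu>) / \<nu>)\<close> with \<open>P = inverse \<Sigma>\<close>; its coefficients are the functions
  \<open>F\<close> and \<open>w\<close>, its monomials are the functions \<open>f\<close>, and \<open>h = 0\<close>. The total mass is computed by a linear
  substitution \<open>x = \<mu> + \<Sigma> V y\<close>, where the columns of \<open>V\<close> are orthonormal for \<open>\<Sigma>\<close>, and by representing
  \<open>(1 + y \<bullet> y / \<nu>) powr (- (\<nu> + d) / 2)\<close> as a Gamma mixture of Gaussians.
\<close>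

section \<open>Linear change of variables\<close>

text \<open>The delicate point is the independence of the weights. They share the factor
  \<open>N powr (\<alpha> - 1) / \<nu>\<close>, which depends on the scale matrix through its
  determinant, so independence cannot be read off from monomials in the parameters. As a function of
  \<open>P\<close> this factor is homogeneous of degree -d / (\<nu> + d); a second-order weight,
  linear in \<open>P\<close> apart from it, has degree \<nu> / (\<nu> + d), which is nonzero because
  \<nu> > 0. This degree is what tells such weights from the constant 1. Taking \<open>h = 0\<close>
  is possible because \<open>F\<close> absorbs the whole constant term and is subject to no
  independence condition. Orthonormality for \<Sigma> replaces a matrix square root:
  \<open>transpose V ** \<Sigma> ** V = mat 1\<close> yields both that the substitution turns the
  quadratic form into \<open>y \<bullet> y\<close> and that its Jacobian is
  \<open>sqrt (det \<Sigma>)\<close>.\<close>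

lemma borel_measurable_vec_lambda:
  fixes f :: "'a \<Rightarrow> 'n::finite \<Rightarrow> real"
  assumes "\<And>i. (\<lambda>x. f x i) \<in> borel_measurable M"
  shows "(\<lambda>x. \<chi> i. f x i) \<in> borel_measurable M"
  using assms by (subst borel_measurable_euclidean_space) (auto simp: Basis_vec_def inner_axis)

text \<open>Lebesgue measure is determined by its values on boxes, where the product measure also
  gives the product of the side lengths. The product over the index type makes it possible to
  integrate a single coordinate first.\<close>

lemma lborel_vec_eq_PiM:
  "(lborel :: (real^'n) measure) = distr (\<Pi>\<^sub>M i\<in>UNIV. lborel) borel (\<lambda>f. \<chi> i. f i)"
proof (rule lborel_eqI)
  interpret product_sigma_finite "\<lambda>i::'n. lborel :: real measure" ..
  have meas[measurable]: "(\<lambda>f. \<chi> i. f i) \<in> (\<Pi>\<^sub>M i\<in>(UNIV::'n set). lborel) \<rightarrow>\<^sub>M (borel :: (real^'n) measure)"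
    by (rule borel_measurable_vec_lambda) simp
  fix l u :: "real^'n" assume le: "\<And>b. b \<in> Basis \<Longrightarrow> l \<bullet> b \<le> u \<bullet> b"
  have le': "l $ i \<le> u $ i" for i
    using le[of "axis i 1"] by (simp add: inner_axis)
  have "(\<lambda>f. \<chi> i. f i) -` box l u \<inter> space (\<Pi>\<^sub>M i\<in>(UNIV::'n set). lborel) = (\<Pi>\<^sub>E i\<in>UNIV. {l$i<..<u$i})"
    by (auto simp: mem_box_cart space_PiM PiE_iff)
  then have "emeasure (distr (\<Pi>\<^sub>M i\<in>UNIV. lborel) borel (\<lambda>f. \<chi> i. f i)) (box l u) = (\<Prod>i\<in>UNIV. ennreal (u$i - l$i))"
    using le' by (simp add: emeasure_distr emeasure_PiM)
  also have "\<dots> = ennreal (\<Prod>i\<in>UNIV. u$i - l$i)"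
    using le' by (intro prod_ennreal) simp
  also have "(\<Prod>i\<in>UNIV. u$i - l$i) = (\<Prod>b\<in>Basis. (u - l) \<bullet> b)"
    by (simp add: Basis_vec_def UNION_singleton_eq_range prod.reindex axis_eq_axis inj_on_def inner_axis)
  finally show "emeasure (distr (\<Pi>\<^sub>M i\<in>UNIV. lborel) borel (\<lambda>f. \<chi> i. f i)) (box l u) = (\<Prod>b\<in>Basis. (u - l) \<bullet> b)" .
qed simp

lemma nn_integral_lborel_vec:
  fixes g :: "real^'n \<Rightarrow> ennreal"
  assumes [measurable]: "g \<in> borel_measurable borel"
  shows "(\<integral>\<^sup>+x. g x \<partial>lborel) = (\<integral>\<^sup>+f. g (\<chi> i. f i) \<partial>(\<Pi>\<^sub>M i\<in>UNIV. lborel))"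
proof -
  have [measurable]: "(\<lambda>f. \<chi> i. f i) \<in> (\<Pi>\<^sub>M i\<in>(UNIV::'n set). lborel) \<rightarrow>\<^sub>M (borel :: (real^'n) measure)"
    by (rule borel_measurable_vec_lambda) simp
  show ?thesis
    by (subst lborel_vec_eq_PiM) (simp add: nn_integral_distr)
qed

text \<open>With the other coordinates held fixed, the shear is a translation of coordinate
  \<open>m\<close>, and Lebesgue measure on the line is translation invariant.\<close>

lemma nn_integral_lborel_shear:
  fixes g :: "real^'n \<Rightarrow> ennreal"
  assumes [measurable]: "g \<in> borel_measurable borel" and "m \<noteq> n"
  shows "(\<integral>\<^sup>+x. g (\<chi> i. if i = m then x$m + x$n else x$i) \<partial>lborel) = (\<integral>\<^sup>+x. g x \<partial>lborel)"
proof -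
  interpret product_sigma_finite "\<lambda>i::'n. lborel :: real measure" ..
  have vec[measurable]: "(\<lambda>f. \<chi> i. f i) \<in> (\<Pi>\<^sub>M i\<in>(UNIV::'n set). lborel) \<rightarrow>\<^sub>M (borel :: (real^'n) measure)"
    by (rule borel_measurable_vec_lambda) simp
  have shear[measurable]: "(\<lambda>x::real^'n. \<chi> i. if i = m then x$m + x$n else x$i) \<in> borel_measurable borel"
    by (rule borel_measurable_vec_lambda) simp
  have iterate: "(\<integral>\<^sup>+x. k x \<partial>lborel) =
      (\<integral>\<^sup>+f. (\<integral>\<^sup>+y. k (\<chi> i. (f(m := y)) i) \<partial>lborel) \<partial>(\<Pi>\<^sub>M i\<in>UNIV - {m}. lborel))"
    if [measurable]: "k \<in> borel_measurable borel" for k :: "real^'n \<Rightarrow> ennreal"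
    using product_nn_integral_insert[of "UNIV - {m}" m "\<lambda>f. k (\<chi> i. f i)"]
    by (simp add: nn_integral_lborel_vec insert_UNIV del: fun_upd_apply)
  have translate: "(\<integral>\<^sup>+y. g (\<chi> i. if i = m then (\<chi> i. (f(m := y)) i) $ m + (\<chi> i. (f(m := y)) i) $ n
          else (\<chi> i. (f(m := y)) i) $ i) \<partial>lborel) = (\<integral>\<^sup>+y. g (\<chi> i. (f(m := y)) i) \<partial>lborel)" for f
  proof -
    have [measurable]: "(\<lambda>y. \<chi> i. (f(m := y)) i) \<in> borel_measurable borel"
      by (rule borel_measurable_vec_lambda) simp
    \<comment> \<open>The shift \<open>f n\<close> does not depend on \<open>y\<close>, because
      \<open>m \<noteq> n\<close> leaves coordinate \<open>n\<close> untouched by the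
      update.\<close>
    have "(\<integral>\<^sup>+y. g (\<chi> i. (f(m := y)) i) \<partial>lborel) = (\<integral>\<^sup>+y. g (\<chi> i. (f(m := f n + 1 * y)) i) \<partial>lborel)"
      by (subst nn_integral_real_affine[of _ 1 "f n"]) (simp_all del: fun_upd_apply)
    then show ?thesis
      using \<open>m \<noteq> n\<close> by (simp add: fun_upd_def add.commute eq_commute cong: if_cong)
  qed
  show ?thesis
    by (simp only: iterate[of "\<lambda>x. g (\<chi> i. if i = m then x$m + x$n else x$i)"] iterate[of g] translate
        measurable_compose[OF shear] assms)
qed

lemma nn_integral_lborel_swap:
  fixes g :: "real^'n \<Rightarrow> ennreal"
  assumes [measurable]: "g \<in> borel_measurable borel"
  shows "(\<integral>\<^sup>+x. g (\<chi> i. x $ Transposition.transpose m n i) \<partial>lborel) = (\<integral>\<^sup>+x. g x \<partial>lborel)"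
proof -
  let ?t = "Transposition.transpose m n"
  let ?h = "\<lambda>x::real^'n. \<chi> i. x $ ?t i"
  have [measurable]: "?h \<in> borel_measurable borel"
    by (rule borel_measurable_vec_lambda) simp
  have "lborel = distr lborel borel ?h"
  proof (rule lborel_eqI)
    fix l u :: "real^'n" assume le: "\<And>b. b \<in> Basis \<Longrightarrow> l \<bullet> b \<le> u \<bullet> b"
    have le': "l $ i \<le> u $ i" for i
      using le[of "axis i 1"] by (simp add: inner_axis)
    have "?h -` box l u = box (?h l) (?h u)"
      by (auto simp: mem_box_cart) (metis transpose_involutory)+
    moreover have "(\<Prod>b\<in>Basis. (?h u - ?h l) \<bullet> b) = (\<Prod>b\<in>Basis. (u - l) \<bullet> b)"
      using prod.permute [OF permutes_swap_id[of m UNIV n], of "\<lambda>i. (u - l)$i"]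
      by (simp add: Basis_vec_def UNION_singleton_eq_range prod.reindex axis_eq_axis inj_on_def inner_axis o_def)
    moreover have "?h l \<bullet> b \<le> ?h u \<bullet> b" if "b \<in> Basis" for b
      using that le' by (auto simp: Basis_vec_def inner_axis)
    ultimately show "emeasure (distr lborel borel ?h) (box l u) = (\<Prod>b\<in>Basis. (u - l) \<bullet> b)"
      by (simp add: emeasure_distr)
  qed simp
  then have "(\<integral>\<^sup>+x. g x \<partial>lborel) = (\<integral>\<^sup>+x. g x \<partial>distr lborel borel ?h)"
    by simp
  then show ?thesis
    by (simp add: nn_integral_distr)
qed

lemma nn_integral_lborel_stretch:
  fixes g :: "real^'n \<Rightarrow> ennreal"
  assumes [measurable]: "g \<in> borel_measurable borel" and c: "\<And>i. c i \<noteq> 0"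
  shows "(\<integral>\<^sup>+x. g x \<partial>lborel) = ennreal \<bar>\<Prod>i\<in>UNIV. c i\<bar> * (\<integral>\<^sup>+x. g (\<chi> i. c i * x $ i) \<partial>lborel)"
proof -
  \<comment> \<open>The affine substitution rule expects one factor per basis vector, so
    \<open>c\<close> is transported along \<open>i \<mapsto> axis i 1\<close>.\<close>
  define C where "C b = c (THE i. b = axis i 1)" for b :: "real^'n"
  have C: "C (axis i 1) = c i" for i
    by (simp add: C_def axis_eq_axis)
  define T where "T = (\<lambda>x. \<chi> i. c i * x $ i :: real^'n)"
  have [measurable]: "T \<in> borel_measurable borel"
    unfolding T_def by (rule borel_measurable_vec_lambda) simp
  have T: "(\<lambda>x. 0 + (\<Sum>j\<in>Basis. (C j * (x \<bullet> j)) *\<^sub>R j)) = T"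
  proof
    fix x :: "real^'n"
    have "(\<Sum>j\<in>Basis. (C j * (x \<bullet> j)) *\<^sub>R j) = (\<Sum>i\<in>UNIV. (C (axis i 1) * (x \<bullet> axis i 1)) *\<^sub>R axis i 1)"
      by (simp add: Basis_vec_def UNION_singleton_eq_range sum.reindex axis_eq_axis inj_on_def)
    then show "0 + (\<Sum>j\<in>Basis. (C j * (x \<bullet> j)) *\<^sub>R j) = T x"
      by (simp add: T_def vec_eq_iff C inner_axis) (simp add: axis_def if_distrib cong: if_cong)
  qed
  have P: "(\<Prod>j\<in>Basis. \<bar>C j\<bar>) = \<bar>\<Prod>i\<in>UNIV. c i\<bar>"
    by (simp add: C Basis_vec_def UNION_singleton_eq_range prod.reindex axis_eq_axis inj_on_def abs_prod)
  have "lborel = density (distr lborel borel T) (\<lambda>_. ennreal \<bar>\<Prod>i\<in>UNIV. c i\<bar>)"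
    using lborel_affine_euclidean[of C 0] c C unfolding T P by (fastforce simp: Basis_vec_def)
  then have "(\<integral>\<^sup>+x. g x \<partial>lborel) = (\<integral>\<^sup>+x. g x \<partial>density (distr lborel borel T) (\<lambda>_. ennreal \<bar>\<Prod>i\<in>UNIV. c i\<bar>))"
    by simp
  also have "\<dots> = ennreal \<bar>\<Prod>i\<in>UNIV. c i\<bar> * (\<integral>\<^sup>+x. g (T x) \<partial>lborel)"
    by (simp add: nn_integral_density nn_integral_distr nn_integral_cmult)
  finally show ?thesis
    by (simp add: T_def)
qed

text \<open>Both the determinant and the substitution formula are compatible with composition, so it
  suffices to treat elementary maps: stretches, swaps and shears. Maps with a vanishing component
  are excluded by the determinant hypothesis.\<close>

lemma nn_integral_lborel_linear:
  fixes f :: "real^'n \<Rightarrow> real^'n" and g :: "real^'n \<Rightarrow> ennreal"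
  assumes "linear f" "det (matrix f) \<noteq> 0" "g \<in> borel_measurable borel"
  shows "(\<integral>\<^sup>+x. g x \<partial>lborel) = ennreal \<bar>det (matrix f)\<bar> * (\<integral>\<^sup>+x. g (f x) \<partial>lborel)"
proof -
  \<comment> \<open>The quantifier over integrands belongs to the induction predicate: for a
    composition, the formula for the outer map is applied to \<open>k\<close> and that for the inner
    map to \<open>k\<close> composed with the outer one.\<close>
  let ?P = "\<lambda>f. det (matrix f) \<noteq> 0 \<longrightarrow> (\<forall>g \<in> borel_measurable borel.
      (\<integral>\<^sup>+x. g x \<partial>lborel) = ennreal \<bar>det (matrix f)\<bar> * (\<integral>\<^sup>+x. g (f x) \<partial>lborel))"
  have "?P f"
    using \<open>linear f\<close>
  proof (rule induct_linear_elementary)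
    fix f g :: "real^'n \<Rightarrow> real^'n"
    assume lin: "linear f" "linear g" and P: "?P f" "?P g"
    have [measurable]: "f \<in> borel_measurable borel"
      using lin by (intro borel_measurable_continuous_onI linear_continuous_on) (simp add: linear_linear)
    have det: "det (matrix (f \<circ> g)) = det (matrix f) * det (matrix g)"
      by (simp add: matrix_compose lin det_mul)
    show "?P (f \<circ> g)"
    proof (intro impI ballI)
      fix k :: "real^'n \<Rightarrow> ennreal" assume [measurable]: "k \<in> borel_measurable borel"
        and "det (matrix (f \<circ> g)) \<noteq> 0"
      then have "(\<integral>\<^sup>+x. k x \<partial>lborel) = ennreal \<bar>det (matrix f)\<bar> * (ennreal \<bar>det (matrix g)\<bar> * (\<integral>\<^sup>+x. k (f (g x)) \<partial>lborel))"
        using P det by simp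
      then show "(\<integral>\<^sup>+x. k x \<partial>lborel) = ennreal \<bar>det (matrix (f \<circ> g))\<bar> * (\<integral>\<^sup>+x. k ((f \<circ> g) x) \<partial>lborel)"
        by (simp add: det abs_mult ennreal_mult mult.assoc)
    qed
  next
    fix f :: "real^'n \<Rightarrow> real^'n" and i
    assume "\<And>x. f x $ i = 0"
    then have "row i (matrix f) = 0"
      by (simp add: row_def matrix_def vec_eq_iff)
    then show "?P f"
      using det_zero_row(1) by blast
  next
    fix c :: "'n \<Rightarrow> real"
    have "det (matrix (\<lambda>x::real^'n. \<chi> i. c i * x $ i)) = (\<Prod>i\<in>UNIV. c i)"
      by (subst det_diagonal) (simp_all add: matrix_def axis_def)
    then show "?P (\<lambda>x. \<chi> i. c i * x $ i)"
      using nn_integral_lborel_stretch[of _ c] by auto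
  next
    fix m n :: 'n assume "m \<noteq> n"
    have "matrix (\<lambda>x::real^'n. \<chi> i. x $ Transposition.transpose m n i) = (\<chi> i. mat 1 $ Transposition.transpose m n i)"
      by (simp add: matrix_def vec_eq_iff axis_def mat_def)
    then have "\<bar>det (matrix (\<lambda>x::real^'n. \<chi> i. x $ Transposition.transpose m n i))\<bar> = 1"
      by (simp add: det_permute_rows permutes_swap_id sign_swap_id abs_mult)
    then show "?P (\<lambda>x. \<chi> i. x $ Transposition.transpose m n i)"
      by (simp add: nn_integral_lborel_swap[where m = m and n = n])
  next
    fix m n :: 'n assume "m \<noteq> n"
    have "matrix (\<lambda>x::real^'n. \<chi> i. if i = m then x$m + x$n else x$i) =
        (\<chi> k. if k = m then row m (mat 1) + 1 *s row n (mat 1) else row k (mat 1))"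
      by (simp add: matrix_def vec_eq_iff axis_def mat_def row_def)
    then have "det (matrix (\<lambda>x::real^'n. \<chi> i. if i = m then x$m + x$n else x$i)) = 1"
      by (simp only: det_row_operation[OF \<open>m \<noteq> n\<close>] det_I)
    then show "?P (\<lambda>x. \<chi> i. if i = m then x$m + x$n else x$i)"
      using \<open>m \<noteq> n\<close> by (simp add: nn_integral_lborel_shear[where m = m and n = n])
  qed
  then show ?thesis
    using assms by blast
qed

section \<open>Positive definite matrices and the Student integral\<close>

lemma matrix_inv_right_left:
  fixes A :: "'a::semiring_1^'n^'m"
  assumes "invertible A"
  shows "A ** matrix_inv A = mat 1" "matrix_inv A ** A = mat 1"
proof -
  have "A ** matrix_inv A = mat 1 \<and> matrix_inv A ** A = mat 1"
    using assms unfolding invertible_def matrix_inv_def by (rule someI_ex)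
  then show "A ** matrix_inv A = mat 1" "matrix_inv A ** A = mat 1"
    by blast+
qed

lemma matrix_inv_eqI:
  fixes A :: "'a::field^'n^'n"
  assumes "A ** B = mat 1"
  shows "matrix_inv A = B"
  by (metis assms invertible_right_inverse matrix_inv_right_left(2) matrix_mul_assoc matrix_mul_lid matrix_mul_rid)

lemma inner_symmetric_matrix:
  fixes A :: "real^'n^'n"
  assumes "transpose A = A"
  shows "x \<bullet> (A *v y) = (A *v x) \<bullet> y"
  by (metis assms dot_lmul_matrix vector_transpose_matrix)

text \<open>Gram-Schmidt for the inner product given by \<open>A\<close>, without projections: the
  next vector is any nonzero one that is orthogonal in the usual sense to all
  \<open>A *v v j\<close>, rescaled.\<close>

lemma spd_orthonormal_family:
  fixes A :: "real^'n^'n"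
  assumes A: "symmetric_positive_definite A"
  shows "\<exists>v :: 'n \<Rightarrow> real^'n. \<forall>i\<in>J. \<forall>j\<in>J. v i \<bullet> (A *v v j) = (if i = j then 1 else 0)"
  using finite[of J]
proof (induction J rule: finite_induct)
  case (insert k J)
  then obtain v :: "'n \<Rightarrow> real^'n" where v: "\<And>i j. i \<in> J \<Longrightarrow> j \<in> J \<Longrightarrow> v i \<bullet> (A *v v j) = (if i = j then 1 else 0)"
    by auto
  \<comment> \<open>As \<open>k\<close> is not in \<open>J\<close>, the vectors
    \<open>A *v v j\<close> are too few to span the space, so such a vector exists.\<close>
  have "dim ((\<lambda>j. A *v v j) ` J) \<le> card J"
    using insert.hyps by (meson card_image_le dim_le_card' finite_imageI le_trans)
  also have "card J < DIM(real^'n)"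
    using insert.hyps psubset_card_mono[of UNIV J] by auto
  finally obtain x where x: "x \<noteq> 0" "\<And>y. y \<in> span ((\<lambda>j. A *v v j) ` J) \<Longrightarrow> orthogonal x y"
    using orthogonal_to_subspace_exists by blast
  then have xv: "x \<bullet> (A *v v j) = 0" if "j \<in> J" for j
    using that by (auto simp: orthogonal_def span_base)
  define r where "r = sqrt (x \<bullet> (A *v x))"
  have r: "r > 0" "x \<bullet> (A *v x) = r * r"
    using A x by (simp_all add: r_def symmetric_positive_definite_def less_imp_le)
  have sym: "v j \<bullet> (A *v x) = x \<bullet> (A *v v j)" for j
    using A by (metis inner_commute inner_symmetric_matrix symmetric_positive_definite_def)
  show ?case
    using insert.hyps v xv r
    by (intro exI[of _ "v(k := (1 / r) *\<^sub>R x)"]) (auto simp: matrix_vector_mult_scaleR sym)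
qed simp

lemma spd_orthonormal_matrix:
  fixes A :: "real^'n^'n"
  assumes "symmetric_positive_definite A"
  obtains V :: "real^'n^'n" where "transpose V ** A ** V = mat 1"
proof -
  obtain v :: "'n \<Rightarrow> real^'n" where v: "\<And>i j. v i \<bullet> (A *v v j) = (if i = j then 1 else 0)"
    using spd_orthonormal_family[OF assms, of UNIV] by auto
  have "(transpose (\<chi> i j. v j $ i) ** (A ** (\<chi> i j. v j $ i))) $ i $ j = v i \<bullet> (A *v v j)" for i j
    by (simp add: matrix_matrix_mult_def matrix_vector_mult_def transpose_def inner_vec_def)
  then have "transpose (\<chi> i j. v j $ i) ** A ** (\<chi> i j. v j $ i) = mat 1"
    using v by (simp add: vec_eq_iff mat_def flip: matrix_mul_assoc)
  then show thesis
    by (rule that)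
qed

lemma det_congruence_mat_1:
  fixes A V :: "'a::comm_ring_1^'n^'n"
  assumes "transpose V ** A ** V = mat 1"
  shows "det V * det V * det A = 1"
proof -
  have "det (transpose V ** A ** V) = 1"
    unfolding assms by (rule det_I)
  then show ?thesis
    by (simp only: det_mul det_transpose ac_simps)
qed

lemma spd_det_pos:
  fixes A :: "real^'n^'n"
  assumes "symmetric_positive_definite A"
  shows "0 < det A"
proof -
  obtain V :: "real^'n^'n" where V: "transpose V ** A ** V = mat 1"
    using spd_orthonormal_matrix[OF assms] .
  have "det V * det V * det A = 1"
    by (rule det_congruence_mat_1[OF V])
  then show ?thesis
    by (metis mult_nonneg_nonpos not_le not_one_le_zero zero_le_square)
qed

lemma spd_invertible: "symmetric_positive_definite A \<Longrightarrow> invertible A"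
  for A :: "real^'n^'n"
  using spd_det_pos[of A] by (simp add: invertible_det_nz)

text \<open>Substituting \<open>x = A *v y\<close> turns the form of the inverse at \<open>x\<close>
  into the form of \<open>A\<close> at \<open>y\<close>.\<close>

lemma spd_matrix_inv:
  fixes A :: "real^'n^'n"
  assumes A: "symmetric_positive_definite A"
  shows "symmetric_positive_definite (matrix_inv A)"
  unfolding symmetric_positive_definite_def
proof (intro conjI allI impI)
  note inv = matrix_inv_right_left[OF spd_invertible[OF A]]
  have "A ** transpose (matrix_inv A) = mat 1"
    using A inv(2) by (metis matrix_transpose_mul symmetric_positive_definite_def transpose_mat)
  then show "transpose (matrix_inv A) = matrix_inv A"
    using matrix_inv_eqI by metis
  fix x :: "real^'n" assume "x \<noteq> 0"
  have x: "x = A *v (matrix_inv A *v x)"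
    by (simp add: matrix_vector_mul_assoc inv)
  then have "matrix_inv A *v x \<noteq> 0"
    using \<open>x \<noteq> 0\<close> by auto
  then have "0 < (matrix_inv A *v x) \<bullet> (A *v (matrix_inv A *v x))"
    using A by (simp add: symmetric_positive_definite_def)
  then show "0 < x \<bullet> (matrix_inv A *v x)"
    using x by (simp add: inner_commute)
qed

lemma nn_integral_elliptical:
  fixes A :: "real^'n^'n" and g :: "real \<Rightarrow> ennreal"
  assumes A: "symmetric_positive_definite A" and [measurable]: "g \<in> borel_measurable borel"
  shows "(\<integral>\<^sup>+x. g ((x - \<mu>) \<bullet> (matrix_inv A *v (x - \<mu>))) \<partial>lborel) =
    ennreal (sqrt (det A)) * (\<integral>\<^sup>+y. g (y \<bullet> y) \<partial>(lborel :: (real^'n) measure))"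
proof -
  obtain V :: "real^'n^'n" where V: "transpose V ** A ** V = mat 1"
    using spd_orthonormal_matrix[OF A] .
  let ?Q = "\<lambda>x. x \<bullet> (matrix_inv A *v x)"
  have mv[measurable]: "(\<lambda>x. B *v x) \<in> borel_measurable borel" for B :: "real^'n^'n"
    by (intro borel_measurable_continuous_onI linear_continuous_on) (simp add: linear_linear)
  have det: "det V * det V * det A = 1"
    by (rule det_congruence_mat_1[OF V])
  \<comment> \<open>Multiply \<open>det V * det V * det A = 1\<close> by
    \<open>det A\<close>.\<close>
  have "(det (A ** V))\<^sup>2 = det A"
    using det unfolding det_mul by algebra
  then have abs_det: "\<bar>det (A ** V)\<bar> = sqrt (det A)"
    by (metis real_sqrt_abs)
  have quad: "?Q ((A ** V) *v y) = y \<bullet> y" for y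
  proof -
    have "?Q ((A ** V) *v y) = ((A ** V) *v y) \<bullet> ((matrix_inv A ** A) *v (V *v y))"
      by (simp add: matrix_vector_mul_assoc matrix_mul_assoc)
    also have "\<dots> = (V *v y) \<bullet> (A *v (V *v y))"
      by (simp add: matrix_inv_right_left[OF spd_invertible[OF A]] inner_commute matrix_vector_mul_assoc)
    also have "\<dots> = y \<bullet> ((transpose V ** A ** V) *v y)"
      by (metis dot_lmul_matrix matrix_mul_assoc matrix_vector_mul_assoc vector_transpose_matrix transpose_transpose)
    finally show ?thesis
      by (simp add: V)
  qed
  have "(\<integral>\<^sup>+x. g (?Q (x - \<mu>)) \<partial>lborel) = (\<integral>\<^sup>+x. g (?Q (x - \<mu>)) \<partial>distr lborel borel ((+) \<mu>))"
    by (simp add: lborel_distr_plus)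
  also have "\<dots> = (\<integral>\<^sup>+x. g (?Q x) \<partial>lborel)"
    by (simp add: nn_integral_distr)
  also have "\<dots> = ennreal \<bar>det (matrix ((*v) (A ** V)))\<bar> * (\<integral>\<^sup>+y. g (?Q ((A ** V) *v y)) \<partial>lborel)"
    using abs_det spd_det_pos[OF A] by (intro nn_integral_lborel_linear) auto
  finally show ?thesis
    by (simp add: quad abs_det)
qed

section \<open>Gaussian and Gamma integrals\<close>

lemma nn_integral_gaussian_real:
  fixes s :: real
  assumes "0 < s"
  shows "(\<integral>\<^sup>+y. ennreal (exp (- s * y\<^sup>2)) \<partial>lborel) = ennreal (sqrt (pi / s))"
proof -
  interpret N: prob_space "density lborel (normal_density 0 (sqrt (1 / (2 * s))))"
    using assms by (intro prob_space_normal_density) simp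
  have "ennreal (exp (- s * y\<^sup>2)) = ennreal (sqrt (pi / s)) * ennreal (normal_density 0 (sqrt (1 / (2 * s))) y)" for y
    using assms by (simp add: normal_density_def real_sqrt_divide field_simps flip: ennreal_mult)
  then have "(\<integral>\<^sup>+y. ennreal (exp (- s * y\<^sup>2)) \<partial>lborel) =
      ennreal (sqrt (pi / s)) * (\<integral>\<^sup>+y. ennreal (normal_density 0 (sqrt (1 / (2 * s))) y) \<partial>lborel)"
    by (simp add: nn_integral_cmult)
  then show ?thesis
    using N.emeasure_space_1 by (simp add: emeasure_density)
qed

lemma nn_integral_gaussian:
  fixes s :: real
  assumes "0 < s"
  shows "(\<integral>\<^sup>+x. ennreal (exp (- s * (x \<bullet> x))) \<partial>(lborel :: 'a::euclidean_space measure)) =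
    ennreal ((pi / s) powr (real DIM('a) / 2))"
proof -
  have "ennreal (exp (- s * (x \<bullet> x))) = (\<Prod>b\<in>Basis. ennreal (exp (- s * (x \<bullet> b)\<^sup>2)))" for x :: 'a
    by (subst euclidean_inner) (simp add: prod_ennreal exp_sum power2_eq_square sum_distrib_left flip: sum_negf)
  then have "(\<integral>\<^sup>+x. ennreal (exp (- s * (x \<bullet> x))) \<partial>(lborel :: 'a measure)) =
      ennreal (sqrt (pi / s)) ^ DIM('a)"
    using nn_integral_lborel_prod[of "\<lambda>(_::'a) y. ennreal (exp (- s * y\<^sup>2))"]
    by (simp add: nn_integral_gaussian_real[OF assms, simplified])
  also have "\<dots> = ennreal ((pi / s) powr (real DIM('a) / 2))"
    using assms by (simp add: ennreal_power powr_half_sqrt[symmetric] powr_powr flip: powr_realpow)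
  finally show ?thesis .
qed

text \<open>Rescaling \<open>t\<close> by \<open>s\<close> in Euler's integral. Read from right to
  left, it writes a negative power of \<open>s\<close> as a superposition of exponentials.\<close>

lemma nn_integral_Gamma_kernel:
  fixes a s :: real
  assumes "0 < a" "0 < s"
  shows "(\<integral>\<^sup>+t. ennreal (indicator {0..} t * t powr (a - 1) * exp (- s * t)) \<partial>lborel) = ennreal (Gamma a * s powr (- a))"
proof -
  let ?I = "\<integral>\<^sup>+t. ennreal (indicator {0..} t * t powr (a - 1) * exp (- s * t)) \<partial>lborel"
  have "ennreal (Gamma a) = ennreal s * (\<integral>\<^sup>+t. ennreal (indicator {0..} (s * t) * (s * t) powr (a - 1) / exp (s * t)) \<partial>lborel)"
    using assms nn_integral_real_affine[of "\<lambda>t. ennreal (indicator {0..} t * t powr (a - 1) / exp t)" s 0]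
    by (simp add: Gamma_conv_nn_integral_real)
  also have "(\<integral>\<^sup>+t. ennreal (indicator {0..} (s * t) * (s * t) powr (a - 1) / exp (s * t)) \<partial>lborel) =
      (\<integral>\<^sup>+t. ennreal (s powr (a - 1)) * ennreal (indicator {0..} t * t powr (a - 1) * exp (- s * t)) \<partial>lborel)"
    using assms by (intro nn_integral_cong)
      (auto simp: indicator_def powr_mult exp_minus divide_simps zero_le_mult_iff simp flip: ennreal_mult)
  also have "\<dots> = ennreal (s powr (a - 1)) * ?I"
    by (simp add: nn_integral_cmult)
  finally have "ennreal (Gamma a) = ennreal (s powr a) * ?I"
    using assms by (simp add: powr_diff flip: mult.assoc ennreal_mult)
  then have "ennreal (s powr (- a)) * ennreal (Gamma a) = ennreal (s powr (- a) * s powr a) * ?I"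
    by (simp add: ennreal_mult mult.assoc)
  then show ?thesis
    using assms by (simp add: mult.commute ennreal_mult Gamma_real_pos less_imp_le flip: powr_add)
qed

text \<open>After the order of integration is exchanged, the Gaussian integral in \<open>x\<close>
  contributes \<open>(\<nu> * pi / t) powr (d / 2)\<close>. This lowers the exponent of
  \<open>t\<close> from \<open>a - 1\<close> to \<open>\<nu> / 2 - 1\<close> and leaves the integral
  for \<open>Gamma (\<nu> / 2)\<close>.\<close>

lemma nn_integral_standard_student:
  fixes \<nu> :: real
  assumes \<nu>: "0 < \<nu>"
  defines "a \<equiv> (\<nu> + real DIM('a)) / 2"
  shows "ennreal (Gamma a) * (\<integral>\<^sup>+x. ennreal ((1 + (x \<bullet> x) / \<nu>) powr (- a)) \<partial>(lborel :: 'a::euclidean_space measure)) =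
    ennreal (Gamma (\<nu> / 2) * (\<nu> * pi) powr (real DIM('a) / 2))"
proof -
  let ?d = "real DIM('a)"
  have a: "0 < a"
    using \<nu> by (simp add: a_def)
  let ?k = "\<lambda>t. indicator {0..} t * t powr (a - 1) * exp (- t) :: real"
  have "ennreal (Gamma a) * (\<integral>\<^sup>+x. ennreal ((1 + (x \<bullet> x) / \<nu>) powr (- a)) \<partial>(lborel :: 'a measure)) =
      (\<integral>\<^sup>+x. ennreal (Gamma a * (1 + (x \<bullet> x) / \<nu>) powr (- a)) \<partial>(lborel :: 'a measure))"
    using a by (simp add: nn_integral_cmult ennreal_mult Gamma_real_pos less_imp_le)
  also have "\<dots> = (\<integral>\<^sup>+x. \<integral>\<^sup>+t. ennreal (indicator {0..} t * t powr (a - 1) * exp (- (1 + (x \<bullet> x) / \<nu>) * t)) \<partial>lborel \<partial>(lborel :: 'a measure))"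
    using a \<nu> by (intro nn_integral_cong nn_integral_Gamma_kernel[symmetric]) (simp_all add: add_pos_nonneg)
  also have "\<dots> = (\<integral>\<^sup>+t. \<integral>\<^sup>+x. ennreal (indicator {0..} t * t powr (a - 1) * exp (- (1 + (x \<bullet> x) / \<nu>) * t)) \<partial>(lborel :: 'a measure) \<partial>lborel)"
    by (rule lborel_pair.Fubini') measurable
  also have "\<dots> = (\<integral>\<^sup>+t. ennreal ((\<nu> * pi) powr (?d / 2)) * ennreal (indicator {0..} t * t powr (\<nu> / 2 - 1) * exp (- 1 * t)) \<partial>lborel)"
  proof (rule nn_integral_cong)
    fix t :: real
    show "(\<integral>\<^sup>+x. ennreal (indicator {0..} t * t powr (a - 1) * exp (- (1 + (x \<bullet> x) / \<nu>) * t)) \<partial>(lborel :: 'a measure)) =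
      ennreal ((\<nu> * pi) powr (?d / 2)) * ennreal (indicator {0..} t * t powr (\<nu> / 2 - 1) * exp (- 1 * t))"
    proof (cases "0 < t")
      case True
      have "(\<integral>\<^sup>+x. ennreal (indicator {0..} t * t powr (a - 1) * exp (- (1 + (x \<bullet> x) / \<nu>) * t)) \<partial>(lborel :: 'a measure)) =
          (\<integral>\<^sup>+x. ennreal (?k t) * ennreal (exp (- (t / \<nu>) * (x \<bullet> x))) \<partial>(lborel :: 'a measure))"
        using True by (intro nn_integral_cong) (simp add: algebra_simps flip: ennreal_mult exp_add)
      also have "\<dots> = ennreal (?k t) * ennreal ((pi / (t / \<nu>)) powr (?d / 2))"
        using True \<nu> by (subst nn_integral_gaussian[symmetric]) (simp_all add: nn_integral_cmult)
      also have "\<dots> = ennreal ((\<nu> * pi) powr (?d / 2)) * ennreal (indicator {0..} t * t powr (\<nu> / 2 - 1) * exp (- 1 * t))"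
      proof -
        have "t powr (a - 1) = t powr (\<nu> / 2 - 1) * t powr (?d / 2)"
          by (simp add: a_def add_divide_distrib algebra_simps flip: powr_add)
        moreover have "(pi / (t / \<nu>)) powr (?d / 2) = (\<nu> * pi) powr (?d / 2) / t powr (?d / 2)"
          using True \<nu> by (simp add: mult.commute flip: powr_divide)
        ultimately show ?thesis
          using True by (simp flip: ennreal_mult)
      qed
      finally show ?thesis .
    \<comment> \<open>For negative \<open>t\<close> the indicator vanishes; at \<open>t = 0\<close>
      both sides vanish because \<open>0 powr z = 0\<close> for every exponent.\<close>
    qed (cases "t = 0"; simp)
  qed
  also have "\<dots> = ennreal ((\<nu> * pi) powr (?d / 2)) * ennreal (Gamma (\<nu> / 2) * 1 powr (- (\<nu> / 2)))"
    using \<nu> by (subst nn_integral_Gamma_kernel[symmetric]) (simp_all add: nn_integral_cmult)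
  finally show ?thesis
    using \<nu> by (simp add: mult.commute Gamma_real_pos less_imp_le flip: ennreal_mult)
qed

section \<open>Symmetric quadratic forms and the parameter space\<close>

lemma det_differentiable:
  fixes M :: "'a::real_normed_vector \<Rightarrow> real^'n^'n"
  assumes "\<And>i j. (\<lambda>x. M x $ i $ j) differentiable (at x within S)"
  shows "(\<lambda>x. det (M x)) differentiable (at x within S)"
proof -
  have "(\<lambda>x. \<Prod>i\<in>I. M x $ i $ p i) differentiable (at x within S)" for p and I :: "'n set"
    by (induction I rule: infinite_finite_induct) (simp_all add: assms)
  then show ?thesis
    unfolding det_def by (intro differentiable_sum differentiable_mult ballI finite_permutations) simp_all
qed

text \<open>Cramer's rule applied to column \<open>j\<close> of the inverse. It exhibits the entries
  as quotients of determinants, hence as differentiable functions.\<close>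

lemma matrix_inv_nth:
  fixes A :: "'a::field^'n^'n"
  assumes "det A \<noteq> 0"
  shows "matrix_inv A $ i $ j = det (\<chi> a b. if b = i then axis j 1 $ a else A $ a $ b) / det A"
proof -
  have "A *v (matrix_inv A *v axis j 1) = axis j 1"
    using assms by (simp add: matrix_vector_mul_assoc matrix_inv_right_left invertible_det_nz)
  then have "matrix_inv A *v axis j 1 = (\<chi> k. det (\<chi> a b. if b = k then axis j 1 $ a else A $ a $ b) / det A)"
    using cramer[OF assms] by blast
  then have "(matrix_inv A *v axis j 1) $ i = det (\<chi> a b. if b = i then axis j 1 $ a else A $ a $ b) / det A"
    by simp
  moreover have "(matrix_inv A *v axis j 1) $ i = matrix_inv A $ i $ j"
    by (simp add: matrix_vector_mult_def axis_def if_distrib cong: if_cong)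
  ultimately show ?thesis
    by simp
qed

lemma matrix_inv_differentiable:
  fixes M :: "'a::real_normed_vector \<Rightarrow> real^'n^'n"
  assumes "\<And>x i j. (\<lambda>x. M x $ i $ j) differentiable (at x)"
    and "x \<in> S" "open S" "\<And>x. x \<in> S \<Longrightarrow> det (M x) \<noteq> 0"
  shows "(\<lambda>x. matrix_inv (M x) $ i $ j) differentiable (at x)"
proof -
  have "(\<lambda>x. (\<chi> a b. if b = i then axis j 1 $ a else M x $ a $ b) $ k $ l) differentiable (at x)" for k l
    by (cases "l = i") (simp_all add: assms)
  then have "(\<lambda>x. det (\<chi> a b. if b = i then axis j 1 $ a else M x $ a $ b) / det (M x)) differentiable (at x)"
    using assms by (intro differentiable_divide det_differentiable) auto
  then obtain D where "((\<lambda>x. det (\<chi> a b. if b = i then axis j 1 $ a else M x $ a $ b) / det (M x)) has_derivative D) (at x)"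
    unfolding differentiable_def ..
  then have "((\<lambda>x. matrix_inv (M x) $ i $ j) has_derivative D) (at x)"
    \<comment> \<open>The quotient formula is known only where the determinant is nonzero; openness
      of \<open>S\<close> makes agreement on \<open>S\<close> enough for the derivative.\<close>
    using \<open>open S\<close> \<open>x \<in> S\<close> by (rule has_derivative_transform_within_open) (simp add: matrix_inv_nth assms(4))
  then show ?thesis
    unfolding differentiable_def by blast
qed

section \<open>Sums and polynomials indexed by the upper triangle\<close>

abbreviation upper_row :: "'d::linorder upper_index \<Rightarrow> 'd" where
  "upper_row p \<equiv> fst (Rep_upper_index p)"

abbreviation upper_col :: "'d::linorder upper_index \<Rightarrow> 'd" where
  "upper_col p \<equiv> snd (Rep_upper_index p)"

lemma upper_row_le_col: "upper_row p \<le> upper_col p"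
  using Rep_upper_index[of p] by auto

lemma upper_index_eqI: "upper_row p = upper_row q \<Longrightarrow> upper_col p = upper_col q \<Longrightarrow> p = q"
  by (simp add: prod_eq_iff flip: Rep_upper_index_inject)

text \<open>Off-diagonal entries of a symmetric matrix occur twice in a quadratic form.\<close>

definition upper_mult :: "'d::linorder upper_index \<Rightarrow> real" where
  "upper_mult p = (if upper_row p = upper_col p then 1 else 2)"

lemma sum_upper_index:
  fixes g :: "'d::{finite,linorder} \<Rightarrow> 'd \<Rightarrow> real"
  assumes sym: "\<And>i j. g i j = g j i"
  shows "(\<Sum>p\<in>UNIV. upper_mult p * g (upper_row p) (upper_col p)) = (\<Sum>i\<in>UNIV. \<Sum>j\<in>UNIV. g i j)"
proof -
  let ?L = "{(i, j). i \<le> j} :: ('d \<times> 'd) set" and ?S = "{(i, j). i < j} :: ('d \<times> 'd) set"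
  have Rep: "bij_betw Rep_upper_index UNIV ?L"
    unfolding bij_betw_def using type_definition.Rep_range[OF type_definition_upper_index]
    by (simp add: inj_on_def Rep_upper_index_inject)
  have "(\<Sum>p\<in>UNIV. upper_mult p * g (upper_row p) (upper_col p)) =
      (\<Sum>(i, j)\<in>?L. g i j + (if i < j then g i j else 0))"
    unfolding sum.reindex_bij_betw[OF Rep, symmetric]
    by (intro sum.cong) (use upper_row_le_col in \<open>auto simp: upper_mult_def split_beta less_le\<close>)
  also have "\<dots> = (\<Sum>(i, j)\<in>?L. g i j) + (\<Sum>(i, j)\<in>?S. g i j)"
    by (auto simp: sum.distrib split_beta sum.inter_filter[symmetric] intro!: arg_cong2[where f = sum])
  also have "(\<Sum>(i, j)\<in>?S. g i j) = (\<Sum>(i, j)\<in>- ?L. g i j)"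
    by (rule sum.reindex_bij_witness[of _ prod.swap prod.swap]) (auto simp: sym)
  also have "(\<Sum>(i, j)\<in>?L. g i j) + (\<Sum>(i, j)\<in>- ?L. g i j) = (\<Sum>(i, j)\<in>UNIV. g i j)"
    by (subst sum.union_disjoint[symmetric]) (auto intro: finite_subset[OF subset_UNIV])
  also have "\<dots> = (\<Sum>i\<in>UNIV. \<Sum>j\<in>UNIV. g i j)"
    by (simp add: sum.cartesian_product)
  finally show ?thesis .
qed

lemma card_upper_index:
  "2 * CARD('d::{finite,linorder} upper_index) = CARD('d::{finite,linorder}) * (CARD('d) + 1)"
proof -
  have row: "(\<Sum>j\<in>UNIV. if i = j then 1 else 1 / 2) = (real CARD('d) + 1) / 2" for i :: 'd
  proof -
    have "(\<Sum>j\<in>UNIV. if i = j then 1 else 1 / 2) = (\<Sum>j\<in>UNIV. 1 / 2 + (if i = j then 1 / 2 else 0 :: real))"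
      by (rule sum.cong) auto
    then show ?thesis
      by (simp add: sum.distrib)
  qed
  \<comment> \<open>The value 1 / 2 off the diagonal cancels the multiplicity 2, so each index
    counts once.\<close>
  have "real CARD('d upper_index) = (\<Sum>p\<in>(UNIV :: 'd upper_index set). upper_mult p * (if upper_row p = upper_col p then 1 else 1 / 2 :: real))"
    by (simp add: upper_mult_def if_distrib cong: if_cong)
  also have "\<dots> = real CARD('d) * ((real CARD('d) + 1) / 2)"
    by (subst sum_upper_index[where g = "\<lambda>i j. if i = j then 1 else 1 / 2"]) (auto simp: row)
  finally have "real (2 * CARD('d upper_index)) = real (CARD('d) * (CARD('d) + 1))"
    by (simp add: algebra_simps)
  then show ?thesis
    by (simp only: of_nat_eq_iff)
qed

lemma card_student_index:
  "CARD('d::{finite,linorder} + 'd::{finite,linorder} upper_index) = CARD('d) * (CARD('d) + 3) div 2"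
proof -
  have "2 * CARD('d + 'd upper_index) = CARD('d) * (CARD('d) + 3)"
    using card_upper_index[where 'd = 'd] by (simp add: card_UNIV_sum algebra_simps)
  then show ?thesis
    by simp
qed

lemma upper_quadratic_zeroD:
  fixes b :: "'d::{finite,linorder} upper_index \<Rightarrow> real"
  assumes "\<And>x :: real^'d::_. (\<Sum>p\<in>UNIV. b p * (x $ upper_row p * x $ upper_col p)) = 0"
  shows "b q = 0"
proof -
  define Q where "Q x = (\<Sum>p\<in>UNIV. b p * (x $ upper_row p * x $ upper_col p))" for x :: "real^'d::_"
  have Q: "Q x = 0" for x
    using assms by (simp add: Q_def)
  define e :: "'d \<Rightarrow> real^'d::_" where "e i = axis i 1" for i
  \<comment> \<open>Polarization at the two unit vectors of \<open>q\<close>. Because rows never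
    exceed columns, only the term \<open>p = q\<close> survives, with factor 2 on the diagonal and 1
    off it.\<close>
  let ?x = "e (upper_row q)" and ?y = "e (upper_col q)"
  have "Q (?x + ?y) - Q ?x - Q ?y =
      (\<Sum>p\<in>UNIV. b p * (?x $ upper_row p * ?y $ upper_col p + ?y $ upper_row p * ?x $ upper_col p))"
    unfolding Q_def sum_subtractf[symmetric] by (intro sum.cong) (simp_all add: algebra_simps)
  also have "\<dots> = (\<Sum>p\<in>UNIV. if p = q then b q * (?x $ upper_row q * ?y $ upper_col q + ?y $ upper_row q * ?x $ upper_col q) else 0)"
  proof (intro sum.cong refl)
    fix p
    show "b p * (?x $ upper_row p * ?y $ upper_col p + ?y $ upper_row p * ?x $ upper_col p) =
        (if p = q then b q * (?x $ upper_row q * ?y $ upper_col q + ?y $ upper_row q * ?x $ upper_col q) else 0)"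
      using upper_row_le_col[of p] upper_row_le_col[of q] upper_index_eqI[of p q]
      by (auto simp: e_def axis_def)
  qed
  finally have "b q * (?x $ upper_row q * ?y $ upper_col q + ?y $ upper_row q * ?x $ upper_col q) = 0"
    using Q by simp
  then show ?thesis
    by (auto simp: e_def axis_def split: if_splits)
qed

definition student_monomial :: "'d::{finite,linorder} + 'd::{finite,linorder} upper_index \<Rightarrow> real^'d::_ \<Rightarrow> real" where
  "student_monomial k x = (case k of Inl i \<Rightarrow> x $ i | Inr p \<Rightarrow> x $ upper_row p * x $ upper_col p)"

lemma sum_student_index:
  "(\<Sum>k\<in>UNIV. g k) = (\<Sum>i\<in>UNIV. g (Inl i)) + (\<Sum>p\<in>UNIV. g (Inr p))"
  for g :: "'d::{finite,linorder} + 'd::{finite,linorder} upper_index \<Rightarrow> real"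
  using sum.Plus[of UNIV UNIV g] by (simp add: o_def)

text \<open>Evaluation at 0 isolates the constant; the substitution \<open>x \<mapsto> - x\<close>
  then separates the odd linear part from the even quadratic part.\<close>

lemma student_monomial_independent:
  fixes a :: "'d::{finite,linorder} + 'd::{finite,linorder} upper_index \<Rightarrow> real"
  assumes eq: "\<And>x :: real^'d::_. a0 + (\<Sum>k\<in>UNIV. a k * student_monomial k x) = 0"
  shows "a0 = 0" "a k = 0"
proof -
  define L where "L x = (\<Sum>i\<in>UNIV. a (Inl i) * x $ i)" for x :: "real^'d::_"
  define Q where "Q x = (\<Sum>p\<in>UNIV. a (Inr p) * (x $ upper_row p * x $ upper_col p))" for x :: "real^'d::_"
  have LQ: "a0 + L x + Q x = 0" for x
    using eq[of x] by (simp add: sum_student_index student_monomial_def L_def Q_def)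
  show a0: "a0 = 0"
    using LQ[of 0] by (simp add: L_def Q_def)
  have "L (- x) = - L x" "Q (- x) = Q x" for x
    by (simp_all add: L_def Q_def sum_negf)
  then have L: "L x = 0" and Q: "Q x = 0" for x
    using LQ[of x] LQ[of "- x"] a0 by simp_all
  have "a (Inl i) = 0" for i
    using L[of "axis i 1"] by (simp add: L_def axis_def if_distrib cong: if_cong)
  moreover have "a (Inr p) = 0" for p
    by (rule upper_quadratic_zeroD[where b = "\<lambda>p. a (Inr p)"]) (use Q in \<open>simp add: Q_def\<close>)
  ultimately show "a k = 0"
    by (cases k) auto
qed

section \<open>Parameters as a vector with a symmetric matrix\<close>

lemma student_scale_nth: "student_scale \<theta> $ i $ j = \<theta> $ Inr (Abs_upper_index (min i j, max i j))"
  by (simp add: student_scale_def)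

lemma transpose_student_scale: "transpose (student_scale \<theta>) = student_scale \<theta>"
  by (simp add: vec_eq_iff transpose_def student_scale_nth min.commute max.commute)

lemma student_params_iff: "\<theta> \<in> student_params \<longleftrightarrow> symmetric_positive_definite (student_scale \<theta>)"
  by (simp add: student_params_def)

definition student_param_of :: "real^'d::_ \<Rightarrow> real^'d::_^'d::_ \<Rightarrow> 'd::{finite,linorder} student_param" where
  "student_param_of m A = (\<chi> k. case k of Inl i \<Rightarrow> m $ i | Inr p \<Rightarrow> A $ upper_row p $ upper_col p)"

lemma student_mean_param_of [simp]: "student_mean (student_param_of m A) = m"
  by (simp add: vec_eq_iff student_mean_def student_param_of_def)

lemma student_scale_param_of:
  assumes "transpose A = A"
  shows "student_scale (student_param_of m A) = A"
proof -
  have "A $ i $ j = A $ j $ i" for i j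
    using assms by (metis transpose_def vec_lambda_beta)
  then show ?thesis
    by (simp add: vec_eq_iff student_scale_nth student_param_of_def min_def max_def Abs_upper_index_inverse)
qed

text \<open>The complement is the projection, along the compact unit sphere, of the closed set where
  the quadratic form is at most 0. Symmetry imposes no condition, since \<open>student_scale\<close>
  produces only symmetric matrices.\<close>

lemma open_student_params: "open (student_params :: 'd::{finite,linorder} student_param set)"
proof -
  let ?T = "{(x :: real^'d::_, \<theta> :: 'd student_param). x \<bullet> (student_scale \<theta> *v x) \<le> 0}"
  have "closed ?T"
    unfolding split_beta inner_vec_def matrix_vector_mult_def student_scale_nth
    by (intro closed_Collect_le) (simp_all, (intro continuous_intros)+)
  then have "closed {\<theta>. \<exists>x. x \<in> sphere 0 1 \<and> (x, \<theta>) \<in> ?T}"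
    by (intro closed_compact_projection) simp_all
  also have "{\<theta>. \<exists>x. x \<in> sphere 0 1 \<and> (x, \<theta>) \<in> ?T} = - student_params"
  proof (intro set_eqI iffI)
    fix \<theta> :: "'d student_param" assume "\<theta> \<in> {\<theta>. \<exists>x. x \<in> sphere 0 1 \<and> (x, \<theta>) \<in> ?T}"
    then obtain x where "norm x = 1" "x \<bullet> (student_scale \<theta> *v x) \<le> 0"
      by auto
    moreover from this have "x \<noteq> 0"
      by auto
    ultimately show "\<theta> \<in> - student_params"
      by (auto simp: student_params_iff symmetric_positive_definite_def not_less)
  next
    fix \<theta> :: "'d student_param" assume "\<theta> \<in> - student_params"
    then obtain x where x: "x \<noteq> 0" "x \<bullet> (student_scale \<theta> *v x) \<le> 0"
      by (auto simp: student_params_iff symmetric_positive_definite_def transpose_student_scale not_less)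
    then have "x /\<^sub>R norm x \<in> sphere 0 1" "(x /\<^sub>R norm x) \<bullet> (student_scale \<theta> *v (x /\<^sub>R norm x)) \<le> 0"
      by (simp_all add: matrix_vector_mult_scaleR mult_nonneg_nonpos)
    then show "\<theta> \<in> {\<theta>. \<exists>x. x \<in> sphere 0 1 \<and> (x, \<theta>) \<in> ?T}"
      unfolding mem_Collect_eq split_conv by blast
  qed
  finally show ?thesis
    by (simp add: open_closed)
qed

section \<open>Student densities as powers of quadratic polynomials\<close>

lemma student_alpha_minus_1: "student_alpha d \<nu> - 1 = - 2 / (\<nu> + real d)"
  by (simp add: student_alpha_def)

context
  fixes \<nu> :: real and \<theta> :: "'d::{finite,linorder} student_param"
  assumes \<nu>: "0 < \<nu>" and \<theta>: "\<theta> \<in> student_params"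
begin

lemma student_scale_spd: "symmetric_positive_definite (student_scale \<theta>)"
  using \<theta> by (simp add: student_params_iff)

lemma student_normalizer_pos: "0 < student_normalizer \<nu> \<theta>"
  using \<nu> spd_det_pos[OF student_scale_spd]
  by (simp add: student_normalizer_def Gamma_real_pos add_pos_nonneg)

lemma student_quadratic_nonneg: "0 \<le> z \<bullet> (matrix_inv (student_scale \<theta>) *v z)"
  using spd_matrix_inv[OF student_scale_spd]
  by (cases "z = 0") (simp_all add: symmetric_positive_definite_def less_imp_le)

lemma student_base_pos: "0 < 1 + 1 / \<nu> * (z \<bullet> (matrix_inv (student_scale \<theta>) *v z))"
  using \<nu> student_quadratic_nonneg by (intro add_pos_nonneg) simp_all

lemma student_density_pos: "0 < student_density \<nu> \<theta> x"
  unfolding student_density_def using student_normalizer_pos student_base_pos[of "x - student_mean \<theta>"] by simp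

lemma student_density_measurable [measurable]: "student_density \<nu> \<theta> \<in> borel_measurable borel"
proof -
  have mv: "continuous_on UNIV (\<lambda>x. B *v f x)" if "continuous_on UNIV f" for B :: "real^'d::_^'d::_" and f :: "real^'d::_ \<Rightarrow> real^'d::_"
    using that by (rule linear_continuous_on_compose) simp
  have "1 + 1 / \<nu> * (z \<bullet> (matrix_inv (student_scale \<theta>) *v z)) \<noteq> 0" for z
    using student_base_pos[of z] by linarith
  then have "continuous_on UNIV (student_density \<nu> \<theta>)"
    unfolding student_density_def by (intro continuous_intros mv) simp_all
  then show ?thesis
    by (rule borel_measurable_continuous_onI)
qed

lemma nn_integral_student_density: "(\<integral>\<^sup>+x. ennreal (student_density \<nu> \<theta> x) \<partial>lborel) = 1"
proof -
  let ?d = "real CARD('d)" and ?N = "student_normalizer \<nu> \<theta>" and ?A = "student_scale \<theta>"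
  let ?a = "(\<nu> + ?d) / 2"
  let ?g = "\<lambda>q. ennreal ((1 + q / \<nu>) powr (- ?a))"
  \<comment> \<open>The denominator of the normalizer without the determinant. The factor
    \<open>sqrt (det ?A)\<close> cancels against the Jacobian of the elliptical
    substitution.\<close>
  define G where "G = Gamma (\<nu> / 2) * (\<nu> * pi) powr (?d / 2)"
  have G: "0 < G"
    using \<nu> by (simp add: G_def Gamma_real_pos)
  have det: "0 < det ?A"
    by (rule spd_det_pos[OF student_scale_spd])
  have exponent: "1 / (student_alpha CARD('d) \<nu> - 1) = - ?a"
    using \<nu> by (simp add: student_alpha_minus_1 field_simps)
  have "(\<integral>\<^sup>+x. ennreal (student_density \<nu> \<theta> x) \<partial>lborel) =
      (\<integral>\<^sup>+x. ennreal ?N * ?g ((x - student_mean \<theta>) \<bullet> (matrix_inv ?A *v (x - student_mean \<theta>))) \<partial>lborel)"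
    using student_normalizer_pos unfolding student_density_def exponent
    by (intro nn_integral_cong) (simp add: less_imp_le flip: ennreal_mult)
  also have "\<dots> = ennreal ?N * (ennreal (sqrt (det ?A)) * (\<integral>\<^sup>+y. ?g (y \<bullet> y) \<partial>(lborel :: (real^'d::_) measure)))"
  proof -
    have [measurable]: "(\<lambda>x. B *v x) \<in> borel_measurable borel" for B :: "real^'d::_^'d::_"
      by (intro borel_measurable_continuous_onI linear_continuous_on) (simp add: linear_linear)
    show ?thesis
      by (subst nn_integral_cmult, measurable) (subst nn_integral_elliptical[OF student_scale_spd], measurable)
  qed
  also have "\<dots> = ennreal (?N * sqrt (det ?A)) * (\<integral>\<^sup>+y. ?g (y \<bullet> y) \<partial>(lborel :: (real^'d::_) measure))"
    using student_normalizer_pos det by (simp add: ennreal_mult mult.assoc)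
  also have "?N * sqrt (det ?A) = (1 / G) * Gamma ?a"
    using det by (simp add: student_normalizer_def G_def)
  also have "ennreal ((1 / G) * Gamma ?a) * (\<integral>\<^sup>+y. ?g (y \<bullet> y) \<partial>(lborel :: (real^'d::_) measure)) =
      ennreal (1 / G) * (ennreal (Gamma ?a) * (\<integral>\<^sup>+y. ?g (y \<bullet> y) \<partial>(lborel :: (real^'d::_) measure)))"
    using G \<nu> by (subst ennreal_mult) (simp_all add: mult.assoc Gamma_real_pos add_pos_nonneg less_imp_le)
  also have "\<dots> = ennreal (1 / G) * ennreal G"
    using nn_integral_standard_student[OF \<nu>, where 'a = "real^'d::_"] by (simp add: G_def)
  also have "\<dots> = 1"
    using G by (simp flip: ennreal_mult)
  finally show ?thesis .
qed

lemma student_density_probability: "probability_density (student_density \<nu> \<theta>)"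
  unfolding probability_density_def
proof (intro conjI allI)
  show "student_density \<nu> \<theta> \<in> borel_measurable lborel"
    by simp
  show "0 \<le> student_density \<nu> \<theta> x" for x
    by (rule less_imp_le[OF student_density_pos])
  show "prob_space (density lborel (\<lambda>x. ennreal (student_density \<nu> \<theta> x)))"
    by standard (simp add: emeasure_density nn_integral_student_density)
qed

lemma student_density_support: "density_support (student_density \<nu> \<theta>) = UNIV"
  by (simp add: density_support_def student_density_pos)

end

text \<open>The factor common to all coefficients once \<open>1 + q / \<nu>\<close> is written as
  \<open>(\<nu> + q) / \<nu>\<close>.\<close>

definition student_coeff :: "real \<Rightarrow> 'd::{finite,linorder} student_param \<Rightarrow> real" where
  "student_coeff \<nu> \<theta> = student_normalizer \<nu> \<theta> powr (student_alpha CARD('d::{finite,linorder}) \<nu> - 1) / \<nu>"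

text \<open>Coefficients of the monomials in the expansion of the form about
  \<open>student_mean \<theta>\<close>. For i < j the monomial \<open>x $ i * x $ j\<close> collects
  two equal matrix entries, hence \<open>upper_mult\<close>.\<close>

definition student_weight ::
    "real \<Rightarrow> 'd::{finite,linorder} + 'd::{finite,linorder} upper_index \<Rightarrow> 'd::{finite,linorder} student_param \<Rightarrow> real" where
  "student_weight \<nu> k \<theta> = student_coeff \<nu> \<theta> *
     (case k of Inl i \<Rightarrow> - 2 * (matrix_inv (student_scale \<theta>) *v student_mean \<theta>) $ i
      | Inr p \<Rightarrow> upper_mult p * matrix_inv (student_scale \<theta>) $ upper_row p $ upper_col p)"

definition student_offset :: "real \<Rightarrow> 'd::{finite,linorder} student_param \<Rightarrow> real" where
  "student_offset \<nu> \<theta> = student_coeff \<nu> \<theta> *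
     (\<nu> + student_mean \<theta> \<bullet> (matrix_inv (student_scale \<theta>) *v student_mean \<theta>))"

lemma student_coeff_pos:
  assumes "0 < \<nu>" "\<theta> \<in> student_params"
  shows "0 < student_coeff \<nu> \<theta>"
  using student_normalizer_pos[OF assms] assms(1) by (simp add: student_coeff_def)

lemma quadratic_form_upper_index:
  fixes P :: "real^'d::{finite,linorder}^'d::{finite,linorder}"
  assumes "transpose P = P"
  shows "x \<bullet> (P *v x) = (\<Sum>p\<in>UNIV. upper_mult p * (P $ upper_row p $ upper_col p * (x $ upper_row p * x $ upper_col p)))"
proof -
  have "P $ i $ j = P $ j $ i" for i j
    using assms by (metis transpose_def vec_lambda_beta)
  then have "(\<Sum>p\<in>UNIV. upper_mult p * (P $ upper_row p $ upper_col p * (x $ upper_row p * x $ upper_col p))) =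
      (\<Sum>i\<in>UNIV. \<Sum>j\<in>UNIV. P $ i $ j * (x $ i * x $ j))"
    by (subst sum_upper_index[where g = "\<lambda>i j. P $ i $ j * (x $ i * x $ j)"]) (auto simp: mult.commute)
  then show ?thesis
    by (simp add: inner_vec_def matrix_vector_mult_def sum_distrib_left ac_simps)
qed

lemma student_density_B_form:
  fixes \<theta> :: "'d::{finite,linorder} student_param"
  assumes \<nu>: "0 < \<nu>" and \<theta>: "\<theta> \<in> student_params"
  defines "B x \<equiv> student_offset \<nu> \<theta> + (\<Sum>k\<in>UNIV. student_weight \<nu> k \<theta> * student_monomial k x)"
  shows "0 < B x" "student_density \<nu> \<theta> x = B x powr (1 / (student_alpha CARD('d::{finite,linorder}) \<nu> - 1))"
proof -
  let ?P = "matrix_inv (student_scale \<theta>)" and ?m = "student_mean \<theta>" and ?c = "student_coeff \<nu> \<theta>"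
  let ?\<beta> = "student_alpha CARD('d) \<nu> - 1"
  let ?q = "(x - ?m) \<bullet> (?P *v (x - ?m))"
  have sym: "transpose ?P = ?P"
    using spd_matrix_inv[OF student_scale_spd[OF \<nu> \<theta>]] by (simp add: symmetric_positive_definite_def)
  have "?q = x \<bullet> (?P *v x) - 2 * (x \<bullet> (?P *v ?m)) + ?m \<bullet> (?P *v ?m)"
    using inner_symmetric_matrix[OF sym, of ?m x]
    by (simp add: matrix_vector_mult_diff_distrib inner_diff_left inner_diff_right inner_commute)
  moreover have "(\<Sum>i\<in>UNIV. student_weight \<nu> (Inl i) \<theta> * student_monomial (Inl i) x) = ?c * (- 2 * (x \<bullet> (?P *v ?m)))"
    by (simp add: student_weight_def student_monomial_def inner_vec_def sum_distrib_left ac_simps sum_negf)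
  moreover have "(\<Sum>p\<in>UNIV. student_weight \<nu> (Inr p) \<theta> * student_monomial (Inr p) x) = ?c * (x \<bullet> (?P *v x))"
    by (simp add: student_weight_def student_monomial_def quadratic_form_upper_index[OF sym] sum_distrib_left ac_simps)
  ultimately have "B x = ?c * (\<nu> + ?q)"
    by (simp add: B_def sum_student_index student_offset_def algebra_simps)
  also have "\<dots> = student_normalizer \<nu> \<theta> powr ?\<beta> * (1 + 1 / \<nu> * ?q)"
    using \<nu> by (simp add: student_coeff_def field_simps)
  finally have B: "B x = student_normalizer \<nu> \<theta> powr ?\<beta> * (1 + 1 / \<nu> * ?q)" .
  note pos = student_normalizer_pos[OF \<nu> \<theta>] student_base_pos[OF \<nu> \<theta>, of "x - ?m"]
  show "0 < B x"
    unfolding B using pos by simp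
  \<comment> \<open>A nonzero exponent allows the power \<open>?\<beta>\<close> of the normalizer to
    be undone.\<close>
  have "?\<beta> \<noteq> 0"
    using \<nu> by (simp add: student_alpha_def)
  then have "(student_normalizer \<nu> \<theta> powr ?\<beta>) powr (1 / ?\<beta>) = student_normalizer \<nu> \<theta>"
    using pos by (simp add: powr_powr)
  then show "student_density \<nu> \<theta> x = B x powr (1 / ?\<beta>)"
    using pos unfolding B student_density_def by (simp only: powr_mult)
qed

section \<open>Differentiability of the coefficients\<close>

lemma vec_nth_differentiable: "(\<lambda>x::real^'n. x $ i) differentiable F"
  by (rule bounded_linear_imp_differentiable[OF bounded_linear_vec_nth])

lemma student_inverse_differentiable:
  assumes "\<theta> \<in> student_params"
  shows "(\<lambda>\<theta>. matrix_inv (student_scale \<theta>) $ i $ j) differentiable (at \<theta>)"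
  using open_student_params assms
  by (intro matrix_inv_differentiable[where S = student_params])
    (auto simp: student_scale_nth vec_nth_differentiable student_params_iff dest: spd_det_pos)

lemma student_coeff_differentiable:
  assumes \<nu>: "0 < \<nu>" and \<theta>: "\<theta> \<in> student_params"
  shows "student_coeff \<nu> differentiable (at \<theta>)"
proof -
  have "(\<lambda>\<theta>. det (student_scale \<theta>)) differentiable (at \<theta>)"
    by (rule det_differentiable) (simp add: student_scale_nth vec_nth_differentiable)
  then obtain D where D: "((\<lambda>\<theta>. det (student_scale \<theta>)) has_derivative D) (at \<theta>)"
    unfolding differentiable_def by blast
  have det: "0 < det (student_scale \<theta>)"
    using \<theta> by (simp add: spd_det_pos student_params_iff)
  have "(\<lambda>\<theta>. sqrt (det (student_scale \<theta>))) differentiable (at \<theta>)"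
    using has_derivative_real_sqrt[OF det D] unfolding differentiable_def by blast
  then have "student_normalizer \<nu> differentiable (at \<theta>)"
    unfolding student_normalizer_def using \<nu> det
    by (intro differentiable_divide differentiable_mult) (auto simp: Gamma_eq_zero_iff)
  then obtain D' where D': "(student_normalizer \<nu> has_derivative D') (at \<theta>)"
    unfolding differentiable_def by blast
  have "(\<lambda>\<theta>. student_normalizer \<nu> \<theta> powr (student_alpha CARD('a) \<nu> - 1)) differentiable (at \<theta>)"
    using has_derivative_powr[OF D' has_derivative_const student_normalizer_pos[OF \<nu> \<theta>] UNIV_I]
    unfolding differentiable_def by blast
  then show ?thesis
    unfolding student_coeff_def using \<nu> by (intro differentiable_divide) auto
qed

lemma student_mean_differentiable: "(\<lambda>\<theta>. student_mean \<theta> $ i) differentiable F"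
  by (simp add: student_mean_def vec_nth_differentiable)

lemma student_weight_differentiable:
  assumes \<nu>: "0 < \<nu>" and \<theta>: "\<theta> \<in> student_params"
  shows "student_weight \<nu> k differentiable (at \<theta>)"
  unfolding student_weight_def
  by (cases k) (auto simp: matrix_vector_mult_def intro!: differentiable_mult differentiable_sum differentiable_minus
      student_coeff_differentiable[OF assms] student_inverse_differentiable[OF \<theta>] student_mean_differentiable)

lemma student_offset_differentiable:
  assumes \<nu>: "0 < \<nu>" and \<theta>: "\<theta> \<in> student_params"
  shows "student_offset \<nu> differentiable (at \<theta>)"
  unfolding student_offset_def
  by (auto simp: matrix_vector_mult_def inner_vec_def intro!: differentiable_mult differentiable_sum differentiable_add
      student_coeff_differentiable[OF assms] student_inverse_differentiable[OF \<theta>] student_mean_differentiable)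

section \<open>Independence of the weights\<close>

lemma det_matrix_inv_scaled:
  fixes P :: "real^'n^'n"
  assumes "det P \<noteq> 0" "c \<noteq> 0"
  shows "det (matrix_inv (mat c ** P)) = det (matrix_inv P) / c ^ CARD('n)"
proof -
  have det_mat: "det (mat c :: real^'n^'n) = c ^ CARD('n)"
    by (subst det_diagonal) (simp_all add: mat_def)
  have "det (matrix_inv B) * det B = 1" if "det B \<noteq> 0" for B :: "real^'n^'n"
    using matrix_inv_right_left(2)[of B] that by (metis det_I det_mul invertible_det_nz)
  from this[of P] this[of "mat c ** P"]
  have "det P * (det (matrix_inv (mat c ** P)) * c ^ CARD('n)) = det P * det (matrix_inv P)"
    using assms by (simp add: det_mul det_mat ac_simps)
  then show ?thesis
    using assms by (simp add: field_simps)
qed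

text \<open>Perturbing the identity by an outer product adds a square to the form. A linear function
  of the matrix that vanishes at all these matrices and at \<open>mat 1\<close> also vanishes at
  every outer product of a vector with itself.\<close>

lemma spd_mat_1_plus_outer:
  "symmetric_positive_definite (mat 1 + (\<chi> i j. v $ i * v $ j) :: real^'n^'n)"
  unfolding symmetric_positive_definite_def
proof (intro conjI allI impI)
  show "transpose (mat 1 + (\<chi> i j. v $ i * v $ j)) = (mat 1 + (\<chi> i j. v $ i * v $ j) :: real^'n^'n)"
    by (auto simp: transpose_def vec_eq_iff mat_def)
  fix x :: "real^'n" assume "x \<noteq> 0"
  have "(\<chi> i j. v $ i * v $ j) *v x = (v \<bullet> x) *\<^sub>R v"
    by (simp add: vec_eq_iff matrix_vector_mult_def inner_vec_def sum_distrib_left sum_distrib_right ac_simps)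
  then have "x \<bullet> ((mat 1 + (\<chi> i j. v $ i * v $ j)) *v x) = x \<bullet> x + (v \<bullet> x)\<^sup>2"
    by (simp add: matrix_vector_mult_add_rdistrib inner_add_right power2_eq_square inner_commute)
  then show "0 < x \<bullet> ((mat 1 + (\<chi> i j. v $ i * v $ j)) *v x)"
    using \<open>x \<noteq> 0\<close> by (simp add: add_pos_nonneg)
qed

lemma mat_mult_eq_scaleR: "mat c ** P = c *\<^sub>R P"
  for P :: "real^'n^'n"
  by (simp add: vec_eq_iff matrix_matrix_mult_def mat_def if_distrib[of "\<lambda>z. z * _"] cong: if_cong)

lemma spd_mat_mult:
  fixes P :: "real^'n^'n"
  assumes "symmetric_positive_definite P" "0 < c"
  shows "symmetric_positive_definite (mat c ** P)"
proof -
  have "transpose (c *\<^sub>R P) = c *\<^sub>R transpose P"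
    by (simp add: vec_eq_iff transpose_def)
  then show ?thesis
    using assms by (simp add: mat_mult_eq_scaleR symmetric_positive_definite_def flip: scaleR_matrix_vector_assoc)
qed

text \<open>
  Parametrize by the precision matrix \<open>P\<close> and by \<open>u = P \<mu>\<close>. Varying \<open>u\<close> isolates the coefficients of
  the linear weights; replacing \<open>P\<close> by \<open>2 P\<close> multiplies the remaining ones by
  \<open>2 powr (\<nu> / (\<nu> + d)) \<noteq> 1\<close>, which separates them from the constant.
\<close>

lemma student_weight_independent:
  fixes a :: "'d::{finite,linorder} + 'd::{finite,linorder} upper_index \<Rightarrow> real"
  assumes \<nu>: "0 < \<nu>"
    and eq: "\<And>\<theta>. \<theta> \<in> student_params \<Longrightarrow> a0 + (\<Sum>k\<in>UNIV. a k * student_weight \<nu> k \<theta>) = 0"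
  shows "a0 = 0" "a k = 0"
proof -
  let ?d = "real CARD('d)" and ?\<beta> = "student_alpha CARD('d) \<nu> - 1"
  define \<kappa> where "\<kappa> P = student_coeff \<nu> (student_param_of 0 (matrix_inv P))" for P :: "real^'d::_^'d::_"
  define L where "L u = (\<Sum>i\<in>UNIV. a (Inl i) * u $ i)" for u :: "real^'d::_"
  define S where "S P = (\<Sum>p\<in>UNIV. (a (Inr p) * upper_mult p) * P $ upper_row p $ upper_col p)" for P :: "real^'d::_^'d::_"
  have param: "student_param_of m (matrix_inv P) \<in> student_params"
      "student_scale (student_param_of m (matrix_inv P)) = matrix_inv P"
    if "symmetric_positive_definite P" for P :: "real^'d::_^'d::_" and m
    using spd_matrix_inv[OF that]
    by (simp_all add: student_params_iff student_scale_param_of symmetric_positive_definite_def)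
  have \<kappa>_pos: "0 < \<kappa> P" if "symmetric_positive_definite P" for P
    unfolding \<kappa>_def using \<nu> param[OF that] by (intro student_coeff_pos)
  have key: "a0 + \<kappa> P * (S P - 2 * L u) = 0" if P: "symmetric_positive_definite P" for P u
  proof -
    let ?\<theta> = "student_param_of (matrix_inv P *v u) (matrix_inv P)"
    note inv = matrix_inv_right_left[OF spd_invertible[OF P]]
    have inv_inv: "matrix_inv (matrix_inv P) = P"
      by (rule matrix_inv_eqI[OF inv(2)])
    have "P *v (matrix_inv P *v u) = u"
      by (simp add: matrix_vector_mul_assoc inv)
    moreover have "student_coeff \<nu> ?\<theta> = \<kappa> P"
      by (simp add: \<kappa>_def student_coeff_def student_normalizer_def param[OF P])
    ultimately have "(\<Sum>i\<in>UNIV. a (Inl i) * student_weight \<nu> (Inl i) ?\<theta>) = \<kappa> P * (- 2 * L u)"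
      "(\<Sum>p\<in>UNIV. a (Inr p) * student_weight \<nu> (Inr p) ?\<theta>) = \<kappa> P * S P"
      by (simp_all add: student_weight_def param[OF P] inv_inv L_def S_def sum_distrib_left sum_negf ac_simps)
    then show ?thesis
      using eq[OF param(1)[OF P, of "matrix_inv P *v u"]] by (simp add: sum_student_index algebra_simps)
  qed
  have spd_1: "symmetric_positive_definite (mat 1 :: real^'d::_^'d::_)"
    using spd_mat_1_plus_outer[of 0] by (simp add: zero_vec_def[symmetric])
  \<comment> \<open>\<open>\<kappa>\<close> does not involve \<open>u\<close>, so comparing with
    \<open>u = 0\<close> leaves a positive multiple of \<open>L u\<close>.\<close>
  have L: "L u = 0" for u
    using key[OF spd_1, of u] key[OF spd_1, of 0] \<kappa>_pos[OF spd_1] by (simp add: L_def algebra_simps)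
  have S: "S P = 0" if P: "symmetric_positive_definite P" for P
  proof -
    let ?r = "2 powr (\<nu> / (\<nu> + ?d)) :: real"
    note P2 = spd_mat_mult[OF P, of 2]
    have S2: "S (mat 2 ** P) = 2 * S P"
      by (simp add: S_def mat_mult_eq_scaleR sum_distrib_left ac_simps)
    \<comment> \<open>Doubling \<open>P\<close> divides the determinant of its inverse by 2 ^ d, so
      the normalizer gains \<open>2 powr (d / 2)\<close> and \<open>\<kappa>\<close> gains
      \<open>2 powr (- d / (\<nu> + d))\<close>. The extra factor 2 comes from the linearity of
      \<open>S\<close>.\<close>
    have \<kappa>2: "\<kappa> (mat 2 ** P) * 2 = \<kappa> P * ?r"
    proof -
      define C where "C = Gamma ((\<nu> + ?d) / 2) / (Gamma (\<nu> / 2) * (\<nu> * pi) powr (?d / 2) * sqrt (det (matrix_inv P)))"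
      have "0 < det (matrix_inv P)"
        using P by (simp add: spd_det_pos spd_matrix_inv)
      then have C: "0 < C"
        using \<nu> by (simp add: C_def Gamma_real_pos add_pos_nonneg)
      have "sqrt (2 ^ CARD('d)) = 2 powr (?d / 2)"
        by (simp add: powr_half_sqrt[symmetric] powr_powr flip: powr_realpow)
      then have "student_normalizer \<nu> (student_param_of 0 (matrix_inv (mat 2 ** P)) :: 'd student_param) = C * 2 powr (?d / 2)"
        using spd_det_pos[OF P] P2
        by (simp add: C_def student_normalizer_def param det_matrix_inv_scaled real_sqrt_divide)
      then have "\<kappa> (mat 2 ** P) * 2 = C powr ?\<beta> / \<nu> * ((2 powr (?d / 2)) powr ?\<beta> * 2)"
        using C by (simp add: \<kappa>_def student_coeff_def powr_mult)
      also have "(2 powr (?d / 2)) powr ?\<beta> * 2 = 2 powr (?d / 2 * ?\<beta> + 1)"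
        by (simp add: powr_powr powr_add)
      also have "?d / 2 * ?\<beta> + 1 = \<nu> / (\<nu> + ?d)"
        using \<nu> by (simp add: student_alpha_minus_1 field_simps)
      also have "C powr ?\<beta> / \<nu> = \<kappa> P"
        by (simp add: \<kappa>_def student_coeff_def student_normalizer_def param[OF P] C_def)
      finally show ?thesis .
    qed
    have "a0 + \<kappa> P * S P = 0"
      using key[OF P, of 0] by (simp add: L)
    moreover have "a0 + \<kappa> (mat 2 ** P) * 2 * S P = 0"
      using key[OF P2, of 0] by (simp add: L S2)
    ultimately have "\<kappa> P * ?r * S P = \<kappa> P * S P"
      unfolding \<kappa>2 by linarith
    moreover have "1 < ?r"
      using \<nu> by (simp add: add_pos_nonneg)
    ultimately show ?thesis
      using \<kappa>_pos[OF P] by (metis less_irrefl mult.right_neutral mult_cancel_left mult_cancel_right)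
  qed
  show "a0 = 0"
    using key[OF spd_1, of 0] S[OF spd_1] by (simp add: L)
  have "a (Inl i) = 0" for i
    using L[of "axis i 1"] by (simp add: L_def axis_def if_distrib cong: if_cong)
  moreover have "a (Inr p) = 0" for p
  proof -
    \<comment> \<open>By linearity this is the difference of \<open>S\<close> at
      \<open>mat 1\<close> plus the outer product and \<open>S\<close> at
      \<open>mat 1\<close>.\<close>
    have "(\<Sum>p\<in>UNIV. (a (Inr p) * upper_mult p) * (v $ upper_row p * v $ upper_col p)) = 0" for v :: "real^'d::_"
      using S[OF spd_mat_1_plus_outer[of v]] S[OF spd_1] by (simp add: S_def algebra_simps sum.distrib)
    then have "a (Inr p) * upper_mult p = 0"
      by (rule upper_quadratic_zeroD)
    then show ?thesis
      by (simp add: upper_mult_def split: if_splits)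
  qed
  ultimately show "a k = 0"
    by (cases k) auto
qed

section \<open>The range of \<alpha> and the assembly\<close>

lemma student_alpha_image:
  assumes "0 < d"
  shows "student_alpha d ` {0<..} = {(real d - 2) / real d <..< 1}"
proof (intro set_eqI iffI)
  fix x assume "x \<in> student_alpha d ` {0<..}"
  then obtain \<nu> where "0 < \<nu>" "x = 1 - 2 / (\<nu> + real d)"
    by (auto simp: student_alpha_def)
  moreover from this have "2 / (\<nu> + real d) < 2 / real d"
    using assms by (intro divide_strict_left_mono) simp_all
  moreover have "(real d - 2) / real d = 1 - 2 / real d"
    using assms by (simp add: diff_divide_distrib)
  ultimately show "x \<in> {(real d - 2) / real d <..< 1}"
    by simp
next
  fix x assume x: "x \<in> {(real d - 2) / real d <..< 1}"
  \<comment> \<open>The candidate for \<nu> solves x = 1 - 2 / (\<nu> + d); the lower bound on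
    \<open>x\<close> is exactly its positivity.\<close>
  then have "0 < 2 / (1 - x) - real d"
    using assms by (simp add: field_simps)
  moreover have "x = student_alpha d (2 / (1 - x) - real d)"
    using x by (simp add: student_alpha_def diff_divide_distrib)
  ultimately show "x \<in> student_alpha d ` {0<..}"
    by blast
qed

lemma sum_atLeast0_fun_upd:
  fixes c :: "nat \<Rightarrow> real"
  shows "(\<Sum>i\<in>{0..s}. c i * (g(0 := (\<lambda>_. 1))) i x) = c 0 + (\<Sum>i=1..s. c i * g i x)"
  by (simp add: sum.atLeast_Suc_atMost)

text \<open>Passes from the natural index type of coordinates and upper-triangle positions to the
  numbering in the definition of regularity, where slot 0 carries the constant function.\<close>

lemma linearly_independent_functions_reindex:
  assumes e: "bij_betw e {1..s::nat} (UNIV :: 'k::finite set)"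
    and indep: "\<And>a0 a k. (\<And>x. x \<in> X \<Longrightarrow> a0 + (\<Sum>k\<in>UNIV. a k * g k x) = 0) \<Longrightarrow> a0 = 0 \<and> a k = 0"
  shows "linearly_independent_functions X {0..s} ((\<lambda>i. g (e i))(0 := (\<lambda>_. 1)))"
  unfolding linearly_independent_functions_def
proof (intro allI impI)
  fix c :: "nat \<Rightarrow> real"
  assume "\<forall>x\<in>X. (\<Sum>i\<in>{0..s}. c i * ((\<lambda>i. g (e i))(0 := (\<lambda>_. 1))) i x) = 0"
  then have zero: "c 0 + (\<Sum>i=1..s. c i * g (e i) x) = 0" if "x \<in> X" for x
    using that by (simp only: sum_atLeast0_fun_upd)
  let ?e' = "inv_into {1..s} e"
  have inv: "?e' (e i) = i" if "i \<in> {1..s}" for i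
    using e that by (simp add: bij_betw_def)
  have "(\<Sum>k\<in>UNIV. c (?e' k) * g k x) = (\<Sum>i=1..s. c i * g (e i) x)" for x
    unfolding sum.reindex_bij_betw[OF e, symmetric] by (rule sum.cong) (simp_all only: inv)
  then have "c 0 + (\<Sum>k\<in>UNIV. c (?e' k) * g k x) = 0" if "x \<in> X" for x
    using zero[OF that] by simp
  then have "c 0 = 0 \<and> c (?e' k) = 0" for k
    by (rule indep)
  then have "c i = 0" if "i \<in> {0..s}" for i
    using that inv[of i] by (cases "i = 0") (simp, metis atLeastAtMost_iff less_one not_less)
  then show "\<forall>i\<in>{0..s}. c i = 0"
    by blast
qed

theorem theorem2:
  fixes \<nu> :: real
  assumes "0 < \<nu>"
  shows "student_alpha CARD('d) ` {0<..} =
           {(real CARD('d) - 2) / real CARD('d) <..< 1} \<and>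
         regular_B_family (student_alpha CARD('d) \<nu>) (CARD('d) * (CARD('d) + 3) div 2)
           (student_params :: 'd::{finite,linorder} student_param set)
           (student_density \<nu>)"
proof
  show "student_alpha CARD('d) ` {0<..} = {(real CARD('d) - 2) / real CARD('d) <..< 1}"
    by (rule student_alpha_image) simp
  let ?\<Theta> = "student_params :: 'd student_param set" and ?k = "CARD('d) * (CARD('d) + 3) div 2"
  \<comment> \<open>The enumeration starts at 1 because slot 0 is reserved for the constant
    function.\<close>
  obtain e :: "nat \<Rightarrow> 'd + 'd upper_index" where e: "bij_betw e {1..?k} UNIV"
    using ex_bij_betw_nat_finite_1[of "UNIV :: ('d + 'd upper_index) set"] unfolding card_student_index by auto
  have "B_family_characterized_by (student_alpha CARD('d) \<nu>) (student_density \<nu>) ?k (\<lambda>_. 0) (student_offset \<nu>)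
      (\<lambda>i. student_weight \<nu> (e i)) (\<lambda>i. student_monomial (e i)) ?\<Theta> (\<lambda>_. UNIV)"
    unfolding B_family_characterized_by_def
  proof (intro conjI ballI allI impI)
    show "student_alpha CARD('d) \<nu> \<noteq> 1"
      using assms by (simp add: student_alpha_def)
    fix \<theta> :: "'d student_param" and x :: "real^'d::_"
    assume \<theta>: "\<theta> \<in> ?\<Theta>"
    have "(\<Sum>i=1..?k. student_weight \<nu> (e i) \<theta> * student_monomial (e i) x) =
        (\<Sum>k\<in>UNIV. student_weight \<nu> k \<theta> * student_monomial k x)"
      by (rule sum.reindex_bij_betw[OF e])
    then show "0 < 0 + student_offset \<nu> \<theta> + (\<Sum>i=1..?k. student_weight \<nu> (e i) \<theta> * student_monomial (e i) x)"
      "student_density \<nu> \<theta> x =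
        (0 + student_offset \<nu> \<theta> + (\<Sum>i=1..?k. student_weight \<nu> (e i) \<theta> * student_monomial (e i) x))
          powr (1 / (student_alpha CARD('d) \<nu> - 1))"
      using student_density_B_form[OF assms \<theta>, of x] by simp_all
  qed (use assms in \<open>auto simp: open_student_params student_density_probability student_density_support
      student_weight_differentiable student_offset_differentiable differentiable_on_def differentiable_at_withinI\<close>)
  moreover have "linearly_independent_functions ?\<Theta> {0..?k} ((\<lambda>i. student_weight \<nu> (e i))(0 := (\<lambda>_. 1)))"
    using student_weight_independent[OF assms] by (intro linearly_independent_functions_reindex[OF e]) blast
  moreover have "linearly_independent_functions UNIV {0..?k} ((\<lambda>i. student_monomial (e i))(0 := (\<lambda>_. 1)))"
    using student_monomial_independent by (intro linearly_independent_functions_reindex[OF e]) blast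
  ultimately show "regular_B_family (student_alpha CARD('d) \<nu>) ?k ?\<Theta> (student_density \<nu>)"
    unfolding regular_B_family_def using card_student_index[where 'd = 'd]
    by (intro conjI exI[of _ ?k] exI[of _ "\<lambda>_. 0"] exI[of _ "student_offset \<nu>"]
        exI[of _ "\<lambda>i. student_weight \<nu> (e i)"] exI[of _ "\<lambda>i. student_monomial (e i)"] exI[of _ "\<lambda>_. UNIV"]) auto
qed

end
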